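(* Let $R=(R(t))_{t\ge 0}$ be a risk reserve process with $R(0)=u>0$ satisfying conditions (i) and (ii) of the context, and assume that the random variables $Y_k:=R(T_{k-1})-R(T_k)$, $k=1,2,\ldots$, are mutually independent. Then for any $u>0$ and $h\ge 0$ the ruin probability $\psi(u)$ satisfies $$\psi(u)=\mathbf{P}\Big[\sup_{k\ge 1}S_k>u\Big]\le e^{-hu}\sup_{k\ge 1}\mathbf{E}e^{hS_k}=e^{-hu}\sup_{k\ge 1}\prod_{j=1}^k\mathbf{E}e^{hY_j},$$ where $S_k=Y_1+Y_2+\cdots+Y_k$. Moreover, the Lundberg inequality $\psi(u)\le e^{-Lu}$ holds for all $u>0$ with $L=L(S_\bullet)$, where $$L(S_\bullet):=\sup\Big\{h\ge 0:\ \sup_{k\ge 1}\mathbf{E}e^{hS_k}\le 1\Big\}.$$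
   Context: $R(t)$, $t\ge 0$, is a risk reserve process (a real-valued stochastic process) with non-random initial reserve $R(0)=u>0$. The ultimate ruin probability is $\psi(u):=\mathbf{P}[\inf_{t\ge 0}R(t)<0\mid R(0)=u]$. Conditions: (i) The process $R(t)$ may have positive jumps only at random or non-random times $T_1,T_2,\ldots$ such that $T_{k+1}>T_k>T_0:=0$ for all $k=1,2,\ldots$ and $T_n\to\infty$ almost surely. (ii) The process $R(t)$ is monotone on each time interval $[T_{k-1},T_k)$, $k=1,2,\ldots$, and $R(0)=u>0$. Convention: expectations $\mathbf{E}e^{hS}$ with $h\ge0$ take values in $(0,\infty]$; an upper bound for $\psi(u)$ may be $+\infty$, in which case it is trivial.
   Formalization: Added assumption: almost surely, R has a positive jump at T_k only if it is nondecreasing on [T_{k-1},T_k). Without it R may fall below 0 before T_k and jump back up, so ψ(u)=1 while sup S_k<u (e.g. T_k=k, R(t)=u-(u+1)t on [0,1), then u+5). *)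

theory Defs
  imports "HOL-Probability.Probability"
begin

(* An upward jump at t means f(t-) < f(t). The left limit is taken in the extended reals because
   a path may decrease to -\<infinity> as t is approached; on monotone stretches Limsup is the limit. *)
definition upward_jump :: "(real \<Rightarrow> real) \<Rightarrow> real \<Rightarrow> bool" where
  "upward_jump f t \<longleftrightarrow> 0 < t \<and> Limsup (at_left t) (\<lambda>s. ereal (f s)) < ereal (f t)"

definition ruin_event :: "'a measure \<Rightarrow> (real \<Rightarrow> 'a \<Rightarrow> real) \<Rightarrow> 'a set" where
  "ruin_event M R = {\<omega> \<in> space M. (INF t\<in>{0..}. ereal (R t \<omega>)) < 0}"

definition ruin_prob :: "'a measure \<Rightarrow> (real \<Rightarrow> 'a \<Rightarrow> real) \<Rightarrow> real \<Rightarrow> real" where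
  "ruin_prob M R u =
     \<P>(\<omega> in M. (INF t\<in>{0..}. ereal (R t \<omega>)) < 0 \<bar> R 0 \<omega> = u)"

definition loss :: "(real \<Rightarrow> 'a \<Rightarrow> real) \<Rightarrow> (nat \<Rightarrow> 'a \<Rightarrow> real) \<Rightarrow> nat \<Rightarrow> 'a \<Rightarrow> real" where
  "loss R T k \<omega> = R (T (k - 1) \<omega>) \<omega> - R (T k \<omega>) \<omega>"

definition total_loss :: "(real \<Rightarrow> 'a \<Rightarrow> real) \<Rightarrow> (nat \<Rightarrow> 'a \<Rightarrow> real) \<Rightarrow> nat \<Rightarrow> 'a \<Rightarrow> real" where
  "total_loss R T k \<omega> = (\<Sum>j=1..k. loss R T j \<omega>)"

definition exp_moment :: "'a measure \<Rightarrow> real \<Rightarrow> ('a \<Rightarrow> real) \<Rightarrow> ennreal" where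
  "exp_moment M h X = (\<integral>\<^sup>+ \<omega>. ennreal (exp (h * X \<omega>)) \<partial>M)"

(* The set contains h = 0 but may be unbounded, in which case the exponent is \<infinity>. *)
definition lundberg_exponent :: "'a measure \<Rightarrow> (nat \<Rightarrow> 'a \<Rightarrow> real) \<Rightarrow> ereal" where
  "lundberg_exponent M S =
     (SUP h\<in>{h::real. 0 \<le> h \<and> (SUP k\<in>{1..}. exp_moment M h (S k)) \<le> 1}. ereal h)"

definition exp_ereal :: "ereal \<Rightarrow> ereal" where
  "exp_ereal x = (if x = \<infinity> then \<infinity> else if x = - \<infinity> then 0 else ereal (exp (real_of_ereal x)))"

end

theory Submission
  imports Defs
begin

(* A monotone stretch of the path that goes below 0 either starts below 0 or, when it decreases, ends
   below 0 because no upward jump can follow it; so ruin occurs iff R (T k) < 0, that is, S_k > u,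
   for some k. For the bound, exp (h S_n) / A_n with A_n = E exp (h S_n) is a martingale; stopping it
   when S first exceeds u gives exp (h u) P (S_k > u for some k) \<le> sup_k A_k without any
   hypothesis on the sign of the increments. *)

section \<open>Ruin along a single path\<close>

lemma negative_at_grid_time:
  fixes f :: "real \<Rightarrow> real" and \<tau> :: "nat \<Rightarrow> real"
  assumes "\<tau> 0 = 0" and "0 \<le> f 0"
    and lim: "filterlim \<tau> at_top sequentially"
    and stretch: "\<And>k. k \<ge> 1 \<Longrightarrow> mono_on {\<tau> (k - 1)..<\<tau> k} f \<or> antimono_on {\<tau> (k - 1)..<\<tau> k} f"
    and jump: "\<And>k. k \<ge> 1 \<Longrightarrow> upward_jump f (\<tau> k) \<Longrightarrow> mono_on {\<tau> (k - 1)..<\<tau> k} f"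
    and "0 \<le> t" and "f t < 0"
  shows "\<exists>k\<ge>1. f (\<tau> k) < 0"
proof -
  obtain N where N: "t < \<tau> N"
    using filterlim_at_top_dense[THEN iffD1, OF lim] by (meson eventually_sequentially order_refl)
  \<comment> \<open>The first grid time strictly after \<open>t\<close>: minimality places
    \<open>t\<close> in the half-open stretch ending at \<open>\<tau> k\<close>.\<close>
  define k where "k = (LEAST k. t < \<tau> k)"
  have k: "t < \<tau> k" unfolding k_def using N by (rule LeastI)
  have "k \<noteq> 0" using k \<open>\<tau> 0 = 0\<close> \<open>0 \<le> t\<close> by (cases k) auto
  then have k1: "k \<ge> 1" and "\<not> t < \<tau> (k - 1)"
    unfolding k_def by (auto intro!: not_less_Least)
  then have t: "t \<in> {\<tau> (k - 1)..<\<tau> k}" using k by auto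
  then have left: "\<tau> (k - 1) \<in> {\<tau> (k - 1)..<\<tau> k}" by auto
  show ?thesis
  proof (cases "mono_on {\<tau> (k - 1)..<\<tau> k} f")
    case True
    then have neg: "f (\<tau> (k - 1)) < 0"
      using mono_onD[OF True left t] t \<open>f t < 0\<close> by auto
    \<comment> \<open>A negative value at the left end rules out the first stretch, since
      \<open>f\<close> starts at a nonnegative value; hence \<open>k - 1\<close> is an admissible
      index.\<close>
    then have "k - 1 \<noteq> 0" using assms(1,2) by (cases "k - 1 = 0") auto
    then have "k - 1 \<ge> 1" by linarith
    with neg show ?thesis by blast
  next
    case False
    then have anti: "antimono_on {\<tau> (k - 1)..<\<tau> k} f" and "\<not> upward_jump f (\<tau> k)"
      using stretch[OF k1] jump[OF k1] by auto
    moreover have "0 < \<tau> k" using k \<open>0 \<le> t\<close> by linarith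
    \<comment> \<open>Without an upward jump, \<open>f (\<tau> k)\<close> stays below the left upper
      limit, which the decrease after \<open>t\<close> keeps below \<open>f t\<close>.\<close>
    ultimately have "ereal (f (\<tau> k)) \<le> Limsup (at_left (\<tau> k)) (\<lambda>s. ereal (f s))"
      by (auto simp: upward_jump_def)
    also have "\<dots> \<le> ereal (f t)"
    proof (rule Limsup_bounded)
      have "eventually (\<lambda>s. s \<in> {t<..<\<tau> k}) (at_left (\<tau> k))"
        using k by (rule eventually_at_left_real)
      then show "eventually (\<lambda>s. ereal (f s) \<le> ereal (f t)) (at_left (\<tau> k))"
      proof eventually_elim
        case (elim s)
        then show ?case using monotone_onD[OF anti t, of s] t by auto
      qed
    qed
    finally show ?thesis using k1 \<open>f t < 0\<close> by auto
  qed
qed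

section \<open>Independence and exponential moments\<close>

context prob_space
begin

text \<open>The pair is read as a family indexed by \<open>bool\<close>, so the product formula for
  finite independent families applies; working in \<open>ennreal\<close> covers infinite
  expectations.\<close>

lemma indep_var_nn_integral_mult:
  fixes X Y :: "'a \<Rightarrow> ennreal"
  assumes "indep_var borel X borel Y"
  shows "(\<integral>\<^sup>+\<omega>. X \<omega> * Y \<omega> \<partial>M) = (\<integral>\<^sup>+\<omega>. X \<omega> \<partial>M) * (\<integral>\<^sup>+\<omega>. Y \<omega> \<partial>M)"
proof -
  have "indep_vars (\<lambda>_. borel) (case_bool X Y) UNIV"
    using assms unfolding indep_var_def
    by (rule indep_vars_cong[THEN iffD1, rotated -1]) (auto split: bool.split)
  from indep_vars_nn_integral[OF _ this] show ?thesis
    by (simp add: UNIV_bool mult.commute)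
qed

text \<open>The exponential turns the sum into a product of independent nonnegative factors.\<close>

lemma exp_moment_sum:
  assumes "finite I" and "indep_vars (\<lambda>_. borel) Y I"
  shows "exp_moment M h (\<lambda>\<omega>. \<Sum>i\<in>I. Y i \<omega>) = (\<Prod>i\<in>I. exp_moment M h (Y i))"
proof -
  have "indep_vars (\<lambda>_. borel) (\<lambda>i \<omega>. ennreal (exp (h * Y i \<omega>))) I"
    using assms(2) by (rule indep_vars_compose2[where Y = "\<lambda>_ x. ennreal (exp (h * x))"]) auto
  from indep_vars_nn_integral[OF assms(1) this] show ?thesis
    using assms(1)
    by (simp add: exp_moment_def sum_distrib_left exp_sum prod_ennreal)
qed

text \<open>Lets \<open>exceed_le\<close> cancel a moment: a strictly positive function cannot have
  integral 0 over a space of mass 1.\<close>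

lemma exp_moment_pos:
  assumes "X \<in> borel_measurable M"
  shows "0 < exp_moment M h X"
proof -
  have "exp_moment M h X \<noteq> 0"
    using assms by (simp add: exp_moment_def nn_integral_0_iff_AE)
  then show ?thesis by (simp add: zero_less_iff_neq_zero)
qed

section \<open>The random walk up to its first passage above \<open>u\<close>\<close>

context
  fixes Y :: "nat \<Rightarrow> 'a \<Rightarrow> real" and u :: real
begin

definition partial_sum :: "nat \<Rightarrow> 'a \<Rightarrow> real" where
  "partial_sum k \<omega> = (\<Sum>j=1..k. Y j \<omega>)"

text \<open>The event that the first passage above \<open>u\<close> comes after time
  \<open>n\<close>; its complement says that the stopped walk has already stopped.\<close>

definition no_exceed :: "nat \<Rightarrow> 'a set" where
  "no_exceed n = {\<omega> \<in> space M. \<forall>m\<in>{1..n}. partial_sum m \<omega> \<le> u}"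

context
  assumes indep: "indep_vars (\<lambda>_. borel) Y {1..}"
begin

lemma measurable_partial_sum [measurable]: "partial_sum k \<in> borel_measurable M"
proof -
  have "Y j \<in> borel_measurable M" if "j \<in> {1..k}" for j
    using indep that by (auto simp: indep_vars_def)
  then show ?thesis unfolding partial_sum_def[abs_def] by (rule borel_measurable_sum)
qed

lemma sets_no_exceed [measurable]: "no_exceed n \<in> sets M"
  unfolding no_exceed_def by measurable

lemma partial_sum_Suc: "partial_sum (Suc n) \<omega> = partial_sum n \<omega> + Y (Suc n) \<omega>"
  by (simp add: partial_sum_def)

lemma exp_moment_partial_sum:
  "exp_moment M h (partial_sum k) = (\<Prod>j=1..k. exp_moment M h (Y j))"
  unfolding partial_sum_def[abs_def]
  by (intro exp_moment_sum indep_vars_subset[OF indep]) auto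

text \<open>The martingale step: the event and \<open>partial_sum n\<close> depend on the first
  \<open>n\<close> increments only, so the factor from the next increment splits off.\<close>

lemma nn_integral_next_step:
  "(\<integral>\<^sup>+\<omega>. indicator (no_exceed n) \<omega> * ennreal (exp (h * partial_sum (Suc n) \<omega>)) \<partial>M) =
   (\<integral>\<^sup>+\<omega>. indicator (no_exceed n) \<omega> * ennreal (exp (h * partial_sum n \<omega>)) \<partial>M) *
     exp_moment M h (Y (Suc n))"
proof -
  \<comment> \<open>\<open>F\<close> and \<open>G\<close> express the two factors through coordinate
    vectors, so that independence of the disjoint blocks \<open>{1..n}\<close> and
    \<open>{Suc n}\<close> can be used.\<close>
  define F :: "(nat \<Rightarrow> real) \<Rightarrow> ennreal" where
    "F x = indicator {x. \<forall>m\<in>{1..n}. (\<Sum>j=1..m. x j) \<le> u} x * ennreal (exp (h * (\<Sum>j=1..n. x j)))" for x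
  define G :: "(nat \<Rightarrow> real) \<Rightarrow> ennreal" where "G x = ennreal (exp (h * x (Suc n)))" for x
  have sum_meas: "(\<lambda>x. \<Sum>j=1..m. x j) \<in> borel_measurable (Pi\<^sub>M {1..n} (\<lambda>_. borel :: real measure))"
    if "m \<le> n" for m
    using that by (intro borel_measurable_sum measurable_component_singleton) auto
  have "Measurable.pred (Pi\<^sub>M {1..n} (\<lambda>_. borel :: real measure)) (\<lambda>x. \<forall>m\<in>{1..n}. (\<Sum>j=1..m. x j) \<le> u)"
    using sum_meas by (intro pred_intros_finite borel_measurable_pred_less) (auto intro!: borel_measurable_le)
  then have F: "F \<in> borel_measurable (Pi\<^sub>M {1..n} (\<lambda>_. borel))"
    using sum_meas[of n] unfolding F_def[abs_def] indicator_def by measurable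
  have G: "G \<in> borel_measurable (Pi\<^sub>M {Suc n} (\<lambda>_. borel))"
    unfolding G_def by measurable
  have "indep_var borel (F \<circ> (\<lambda>\<omega>. restrict (\<lambda>i. Y i \<omega>) {1..n}))
          borel (G \<circ> (\<lambda>\<omega>. restrict (\<lambda>i. Y i \<omega>) {Suc n}))"
    by (rule indep_var_compose[OF indep_var_restrict[OF indep] F G]) auto
  from indep_var_nn_integral_mult[OF this]
  have FG: "(\<integral>\<^sup>+\<omega>. F (restrict (\<lambda>i. Y i \<omega>) {1..n}) * G (restrict (\<lambda>i. Y i \<omega>) {Suc n}) \<partial>M) =
     (\<integral>\<^sup>+\<omega>. F (restrict (\<lambda>i. Y i \<omega>) {1..n}) \<partial>M) * (\<integral>\<^sup>+\<omega>. G (restrict (\<lambda>i. Y i \<omega>) {Suc n}) \<partial>M)"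
    by simp
  have F_eq: "F (restrict (\<lambda>i. Y i \<omega>) {1..n}) =
      indicator (no_exceed n) \<omega> * ennreal (exp (h * partial_sum n \<omega>))" if "\<omega> \<in> space M" for \<omega>
  proof -
    have "(\<Sum>j=1..m. restrict (\<lambda>i. Y i \<omega>) {1..n} j) = partial_sum m \<omega>" if "m \<le> n" for m
      unfolding partial_sum_def using that by (intro sum.cong) auto
    then show ?thesis
      using that by (auto simp: F_def no_exceed_def indicator_def)
  qed
  have G_eq: "G (restrict (\<lambda>i. Y i \<omega>) {Suc n}) = ennreal (exp (h * Y (Suc n) \<omega>))" for \<omega>
    by (simp add: G_def)
  have "(\<integral>\<^sup>+\<omega>. indicator (no_exceed n) \<omega> * ennreal (exp (h * partial_sum (Suc n) \<omega>)) \<partial>M) =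
     (\<integral>\<^sup>+\<omega>. F (restrict (\<lambda>i. Y i \<omega>) {1..n}) * G (restrict (\<lambda>i. Y i \<omega>) {Suc n}) \<partial>M)"
    by (intro nn_integral_cong)
       (simp add: F_eq[unfolded One_nat_def] G_eq partial_sum_Suc distrib_left exp_add ennreal_mult mult.assoc)
  also note FG
  also have "(\<integral>\<^sup>+\<omega>. F (restrict (\<lambda>i. Y i \<omega>) {1..n}) \<partial>M) =
     (\<integral>\<^sup>+\<omega>. indicator (no_exceed n) \<omega> * ennreal (exp (h * partial_sum n \<omega>)) \<partial>M)"
    by (intro nn_integral_cong F_eq)
  finally show ?thesis unfolding G_eq exp_moment_def .
qed

(* Optional stopping for exp (h S_n) / A_n, multiplied by A_n * B so that nothing has to be divided
   in ennreal. *)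
lemma stopped_walk_bound:
  assumes "0 \<le> h" and B: "\<And>k. 1 \<le> k \<Longrightarrow> exp_moment M h (partial_sum k) \<le> B"
  shows "ennreal (exp (h * u)) * emeasure M (space M - no_exceed n) * exp_moment M h (partial_sum n) +
      (\<integral>\<^sup>+\<omega>. indicator (no_exceed n) \<omega> * ennreal (exp (h * partial_sum n \<omega>)) \<partial>M) * B
    \<le> exp_moment M h (partial_sum n) * B"
proof (induction n)
  case 0
  have "no_exceed 0 = space M" by (auto simp: no_exceed_def)
  moreover have "(\<integral>\<^sup>+\<omega>. indicator (space M) \<omega> * ennreal (exp (h * partial_sum 0 \<omega>)) \<partial>M) =
      exp_moment M h (partial_sum 0)"
    unfolding exp_moment_def by (intro nn_integral_cong) simp
  ultimately show ?case by simp
next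
  case (Suc n)
  \<comment> \<open>\<open>p\<close> is the probability of passage by time \<open>n\<close>,
    \<open>q\<close> that of first passage exactly at \<open>Suc n\<close>; \<open>E D\<close> is
    the part of the new moment carried by \<open>D\<close>.\<close>
  define p where "p = emeasure M (space M - no_exceed n)"
  define q where "q = emeasure M (no_exceed n - no_exceed (Suc n))"
  define E where "E = (\<lambda>D. \<integral>\<^sup>+\<omega>. indicator D \<omega> * ennreal (exp (h * partial_sum (Suc n) \<omega>)) \<partial>M)"
  let ?I = "\<integral>\<^sup>+\<omega>. indicator (no_exceed n) \<omega> * ennreal (exp (h * partial_sum n \<omega>)) \<partial>M"
  let ?A = "\<lambda>n. exp_moment M h (partial_sum n)"
  let ?a = "exp_moment M h (Y (Suc n))"
  let ?e = "ennreal (exp (h * u))"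
  have A: "?A (Suc n) = ?A n * ?a" by (simp add: exp_moment_partial_sum)
  have sub: "no_exceed (Suc n) \<subseteq> no_exceed n" by (auto simp: no_exceed_def)
  then have "space M - no_exceed (Suc n) = (space M - no_exceed n) \<union> (no_exceed n - no_exceed (Suc n))"
    using sets.sets_into_space[OF sets_no_exceed[of n]] by auto
  then have pq: "emeasure M (space M - no_exceed (Suc n)) = p + q"
    unfolding p_def q_def by (simp only:) (intro plus_emeasure[symmetric]; auto)
  have E_split: "E (no_exceed n) = E (no_exceed n - no_exceed (Suc n)) + E (no_exceed (Suc n))"
    unfolding E_def using sub
    by (subst nn_integral_add[symmetric]) (auto intro!: nn_integral_cong split: split_indicator)
  \<comment> \<open>A Markov-type estimate: at first passage the walk lies above \<open>u\<close>,
    and \<open>h\<close> is nonnegative.\<close>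
  have "?e * q = (\<integral>\<^sup>+\<omega>. ?e * indicator (no_exceed n - no_exceed (Suc n)) \<omega> \<partial>M)"
    unfolding q_def by (subst nn_integral_cmult_indicator) auto
  also have "\<dots> \<le> E (no_exceed n - no_exceed (Suc n))"
    unfolding E_def
  proof (intro nn_integral_mono)
    fix \<omega> assume "\<omega> \<in> space M"
    have "exp (h * u) \<le> exp (h * partial_sum (Suc n) \<omega>)" if "\<omega> \<in> no_exceed n - no_exceed (Suc n)"
    proof -
      have "u \<le> partial_sum (Suc n) \<omega>"
        using that by (force simp: no_exceed_def atLeastAtMostSuc_conv)
      then show ?thesis using \<open>0 \<le> h\<close> by (simp add: mult_left_mono)
    qed
    then show "?e * indicator (no_exceed n - no_exceed (Suc n)) \<omega>
        \<le> indicator (no_exceed n - no_exceed (Suc n)) \<omega> * ennreal (exp (h * partial_sum (Suc n) \<omega>))"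
      by (auto split: split_indicator intro: ennreal_leI)
  qed
  finally have q: "?e * q \<le> E (no_exceed n - no_exceed (Suc n))" .
  have "?e * (p + q) * ?A (Suc n) + E (no_exceed (Suc n)) * B
      = ?e * p * ?A (Suc n) + (?e * q) * ?A (Suc n) + E (no_exceed (Suc n)) * B"
    by (simp add: distrib_left distrib_right)
  \<comment> \<open>For the newly stopped mass, the Markov-type estimate combines with the bound of
    \<open>?A (Suc n)\<close> by \<open>B\<close>; the pieces of \<open>E\<close> then
    recombine.\<close>
  also have "\<dots> \<le> ?e * p * ?A (Suc n) + E (no_exceed n - no_exceed (Suc n)) * B + E (no_exceed (Suc n)) * B"
    using q B[of "Suc n"] by (intro add_mono mult_mono) auto
  also have "\<dots> = ?e * p * ?A (Suc n) + E (no_exceed n) * B"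
    by (simp add: E_split distrib_right add.assoc)
  \<comment> \<open>Both the new moment and the surviving integral carry the factor
    \<open>?a\<close>; taking it out leaves the induction hypothesis.\<close>
  also have "\<dots> = (?e * p * ?A n + ?I * B) * ?a"
    unfolding E_def nn_integral_next_step by (simp add: A distrib_left distrib_right mult_ac)
  also have "\<dots> \<le> (?A n * B) * ?a"
    using Suc.IH unfolding p_def by (rule mult_right_mono) simp
  also have "\<dots> = ?A (Suc n) * B"
    by (simp add: A mult_ac)
  finally show ?case unfolding pq E_def .
qed

text \<open>In \<open>stopped_walk_bound\<close> the surviving integral is dropped and the moment at
  time \<open>n\<close> cancelled. An infinite supremum makes the claim trivial; otherwise that
  moment is positive and finite.\<close>

lemma exceed_le:
  assumes "0 \<le> h"
  shows "ennreal (exp (h * u)) * emeasure M (space M - no_exceed n)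
    \<le> (SUP k\<in>{1..}. exp_moment M h (partial_sum k))" (is "?l \<le> ?B")
proof (cases "?B = \<infinity>")
  case True
  show ?thesis unfolding True by simp
next
  case False
  have le: "exp_moment M h (partial_sum k) \<le> ?B" if "1 \<le> k" for k
    using that by (auto intro: SUP_upper)
  have "exp_moment M h (partial_sum n) \<noteq> \<infinity>"
  \<comment> \<open>The supremum starts at index 1, so time 0 is treated separately: its moment is
    an empty product, equal to 1.\<close>
  proof (cases "n = 0")
    case True
    then show ?thesis by (simp add: exp_moment_partial_sum)
  next
    case n: False
    then have "1 \<le> n" by simp
    from le[OF this] False show ?thesis by (metis infinity_ennreal_def top_unique)
  qed
  then have fin: "exp_moment M h (partial_sum n) < top"
    by (simp add: less_top)
  have "exp_moment M h (partial_sum n) * ?l \<le> exp_moment M h (partial_sum n) * ?B"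
    using order_trans[OF add_increasing2[OF zero_le order_refl] stopped_walk_bound[OF assms, of ?B n]] le
    by (simp add: mult_ac)
  then show ?thesis
    using fin exp_moment_pos[OF measurable_partial_sum, of h n]
    by (simp add: ennreal_mult_le_mult_iff)
qed

text \<open>The events of passage by time \<open>n\<close> increase to the event of passage at some
  time, so continuity from below removes the finite horizon from \<open>exceed_le\<close>.\<close>

lemma maximal_inequality:
  assumes "0 \<le> h"
  shows "emeasure M {\<omega> \<in> space M. \<exists>k\<ge>1. u < partial_sum k \<omega>}
    \<le> ennreal (exp (- h * u)) * (SUP k\<in>{1..}. exp_moment M h (partial_sum k))"
proof -
  have "{\<omega> \<in> space M. \<exists>k\<ge>1. u < partial_sum k \<omega>} = (\<Union>n. space M - no_exceed n)"
    by (auto simp: no_exceed_def not_le) (meson atLeastAtMost_iff not_le order_refl)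
  also have "emeasure M \<dots> = (SUP n. emeasure M (space M - no_exceed n))"
    by (rule SUP_emeasure_incseq[symmetric]) (auto simp: incseq_def no_exceed_def)
  also have "\<dots> \<le> ennreal (exp (- h * u)) * (SUP k\<in>{1..}. exp_moment M h (partial_sum k))"
  proof (rule SUP_least)
    fix n
    have "emeasure M (space M - no_exceed n) =
        ennreal (exp (- h * u)) * (ennreal (exp (h * u)) * emeasure M (space M - no_exceed n))"
      by (simp flip: mult.assoc ennreal_mult exp_add)
    also have "\<dots> \<le> ennreal (exp (- h * u)) * (SUP k\<in>{1..}. exp_moment M h (partial_sum k))"
      by (intro mult_left_mono exceed_le assms) simp
    finally show "emeasure M (space M - no_exceed n)
      \<le> ennreal (exp (- h * u)) * (SUP k\<in>{1..}. exp_moment M h (partial_sum k))" .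
  qed
  finally show ?thesis .
qed

end

end

end

section \<open>Passing to the supremum of the exponents\<close>

text \<open>For positive \<open>p\<close>, logarithms bound every exponent by
  \<open>- ln p / u\<close>; the supremum is then finite and inherits the bound, attained or not.
  For \<open>p \<le> 0\<close> the supremum may be infinite, but \<open>exp_ereal\<close> is never
  negative.\<close>

lemma le_exp_ereal_SUP:
  fixes p u :: real
  assumes "0 < u" and "0 \<in> H" and H: "\<And>h. h \<in> H \<Longrightarrow> p \<le> exp (- h * u)"
  shows "ereal p \<le> exp_ereal (- ((SUP h\<in>H. ereal h) * ereal u))"
proof (cases "p \<le> 0")
  case True
  have "0 \<le> exp_ereal x" for x
    by (auto simp: exp_ereal_def)
  moreover have "ereal p \<le> 0" using True by simp
  ultimately show ?thesis by (rule order_trans[rotated])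
next
  case False
  have "(SUP h\<in>H. ereal h) \<le> ereal (- ln p / u)"
  proof (rule SUP_least)
    fix h assume "h \<in> H"
    then have "ln p \<le> - h * u"
      using H False by (metis ln_exp ln_le_cancel_iff exp_gt_zero not_le)
    then show "ereal h \<le> ereal (- ln p / u)"
      using \<open>0 < u\<close> by (simp add: field_simps)
  qed
  moreover have "0 \<le> (SUP h\<in>H. ereal h)"
    using \<open>0 \<in> H\<close> by (rule SUP_upper2) simp
  ultimately obtain L where L: "(SUP h\<in>H. ereal h) = ereal L" "L \<le> - ln p / u"
    by (cases "SUP h\<in>H. ereal h") auto
  then have "ln p \<le> - (L * u)"
    using \<open>0 < u\<close> by (simp add: field_simps)
  then have "p \<le> exp (- (L * u))"
    using False by (metis exp_le_cancel_iff exp_ln not_le)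
  then show ?thesis by (simp add: L exp_ereal_def)
qed

section \<open>The ruin probability as a passage probability, and its bounds\<close>

theorem theorem1:
  fixes M :: "'a measure"
    and R :: "real \<Rightarrow> 'a \<Rightarrow> real"
    and T :: "nat \<Rightarrow> 'a \<Rightarrow> real"
    and u :: real
  assumes "prob_space M"
    and "\<And>t. 0 \<le> t \<Longrightarrow> R t \<in> borel_measurable M"
    and "\<And>k. T k \<in> borel_measurable M"
    and "ruin_event M R \<in> sets M"
    and "0 < u"
    and "AE \<omega> in M. R 0 \<omega> = u"
    and "\<And>\<omega>. \<omega> \<in> space M \<Longrightarrow> T 0 \<omega> = 0"
    and "AE \<omega> in M. strict_mono (\<lambda>k. T k \<omega>)"
    and "AE \<omega> in M. filterlim (\<lambda>k. T k \<omega>) at_top sequentially"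
    and "AE \<omega> in M. \<forall>t. upward_jump (\<lambda>s. R s \<omega>) t \<longrightarrow> (\<exists>k\<ge>1. t = T k \<omega>)"
    and "AE \<omega> in M. \<forall>k\<ge>1. mono_on {T (k - 1) \<omega>..<T k \<omega>} (\<lambda>t. R t \<omega>) \<or>
                              antimono_on {T (k - 1) \<omega>..<T k \<omega>} (\<lambda>t. R t \<omega>)"
    (* Needed for ruin to be visible at the times T k: without it a path may decrease below 0
       before T k and jump back above 0 at T k. *)
    and "AE \<omega> in M. \<forall>k\<ge>1. upward_jump (\<lambda>s. R s \<omega>) (T k \<omega>) \<longrightarrow>
                              mono_on {T (k - 1) \<omega>..<T k \<omega>} (\<lambda>t. R t \<omega>)"
    and "prob_space.indep_vars M (\<lambda>_. borel) (loss R T) {1..}"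
  shows "ruin_prob M R u = \<P>(\<omega> in M. ereal u < (SUP k\<in>{1..}. ereal (total_loss R T k \<omega>))) \<and>
         (\<forall>h\<ge>0.
            ennreal (ruin_prob M R u)
              \<le> ennreal (exp (- h * u)) * (SUP k\<in>{1..}. exp_moment M h (total_loss R T k)) \<and>
            ennreal (exp (- h * u)) * (SUP k\<in>{1..}. exp_moment M h (total_loss R T k))
              = ennreal (exp (- h * u)) * (SUP k\<in>{1..}. \<Prod>j=1..k. exp_moment M h (loss R T j))) \<and>
         ereal (ruin_prob M R u)
           \<le> exp_ereal (- (lundberg_exponent M (total_loss R T) * ereal u))"
proof -
  interpret prob_space M by fact
  note R_meas = assms(2)
  let ?S = "total_loss R T"
  define hit where "hit = {\<omega> \<in> space M. \<exists>k\<ge>1. u < ?S k \<omega>}"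
  have S_eq: "?S = partial_sum (loss R T)"
    by (intro ext) (simp add: total_loss_def partial_sum_def)
  have S_meas [measurable]: "?S k \<in> borel_measurable M" for k
    unfolding S_eq by (rule measurable_partial_sum[OF assms(13)])
  have hit_sets: "hit \<in> sets M" unfolding hit_def by measurable
  have hit_SUP: "{\<omega> \<in> space M. ereal u < (SUP k\<in>{1..}. ereal (?S k \<omega>))} = hit"
    by (auto simp: hit_def less_SUP_iff)
  \<comment> \<open>The losses telescope: once the reserve starts at \<open>u\<close>, the walk
    exceeds \<open>u\<close> exactly when the reserve at \<open>T k\<close> is negative.\<close>
  have S_tele: "?S k \<omega> = R (T 0 \<omega>) \<omega> - R (T k \<omega>) \<omega>" for k \<omega>
    unfolding total_loss_def by (induction k) (simp_all add: loss_def)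
  have ruin_iff: "\<omega> \<in> ruin_event M R \<longleftrightarrow> \<omega> \<in> space M \<and> (\<exists>t\<ge>0. R t \<omega> < 0)" for \<omega>
    by (auto simp: ruin_event_def INF_less_iff)
  \<comment> \<open>Ruin at some time yields a negative value at a grid time by
    \<open>negative_at_grid_time\<close>; conversely, grid times are nonnegative and so count as
    times of ruin.\<close>
  have ae: "AE \<omega> in M. (\<omega> \<in> ruin_event M R \<and> R 0 \<omega> = u \<longleftrightarrow> \<omega> \<in> hit)"
    using assms(6,8,9,11,12) AE_space
  proof eventually_elim
    case (elim \<omega>)
    have T0: "T 0 \<omega> = 0" using elim assms(7) by simp
    have hit: "\<omega> \<in> hit \<longleftrightarrow> (\<exists>k\<ge>1. R (T k \<omega>) \<omega> < 0)"
      using elim by (simp add: hit_def S_tele T0)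
    have "0 \<le> T k \<omega>" for k
      using strict_mono_leD[OF elim(2), of 0 k] T0 by simp
    moreover have "\<exists>k\<ge>1. R (T k \<omega>) \<omega> < 0" if "0 \<le> t" "R t \<omega> < 0" for t
      using negative_at_grid_time[of "\<lambda>k. T k \<omega>" "\<lambda>s. R s \<omega>" t] T0 elim that \<open>0 < u\<close> by auto
    ultimately show ?case using elim unfolding hit ruin_iff by blast
  qed
  \<comment> \<open>The conditioning event has probability 1, so the conditional probability equals
    that of the intersection.\<close>
  have ruin_prob_eq: "ruin_prob M R u = measure M hit"
  proof -
    have [measurable]: "R 0 \<in> borel_measurable M" using R_meas by simp
    have R0: "{\<omega> \<in> space M. R 0 \<omega> = u} \<in> sets M" by measurable
    have "measure M {\<omega> \<in> space M. R 0 \<omega> = u} = 1"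
      using assms(6) R0 by (simp add: prob_Collect_eq_1)
    moreover have "measure M {\<omega> \<in> space M. (INF t\<in>{0..}. ereal (R t \<omega>)) < 0 \<and> R 0 \<omega> = u} = measure M hit"
    proof (rule measure_eq_AE)
      show "AE \<omega> in M. \<omega> \<in> {\<omega> \<in> space M. (INF t\<in>{0..}. ereal (R t \<omega>)) < 0 \<and> R 0 \<omega> = u} \<longleftrightarrow> \<omega> \<in> hit"
        using ae AE_space by eventually_elim (auto simp: ruin_event_def)
      \<comment> \<open>The infimum runs over uncountably many times; measurability is inherited
        from that assumed for \<open>ruin_event\<close>.\<close>
      have "{\<omega> \<in> space M. (INF t\<in>{0..}. ereal (R t \<omega>)) < 0 \<and> R 0 \<omega> = u} =
          ruin_event M R \<inter> {\<omega> \<in> space M. R 0 \<omega> = u}"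
        by (auto simp: ruin_event_def)
      then show "{\<omega> \<in> space M. (INF t\<in>{0..}. ereal (R t \<omega>)) < 0 \<and> R 0 \<omega> = u} \<in> sets M"
        using assms(4) R0 by simp
    qed (rule hit_sets)
    ultimately show ?thesis by (simp add: ruin_prob_def cond_prob_def)
  qed
  have bound: "ennreal (ruin_prob M R u) \<le> ennreal (exp (- h * u)) * (SUP k\<in>{1..}. exp_moment M h (?S k))"
    if "0 \<le> h" for h
    using maximal_inequality[OF assms(13) that, of u]
    by (simp add: ruin_prob_eq hit_def S_eq emeasure_eq_measure)
  have lundberg: "ruin_prob M R u \<le> exp (- h * u)"
    if "0 \<le> h" "(SUP k\<in>{1..}. exp_moment M h (?S k)) \<le> 1" for h
  proof -
    have "ennreal (ruin_prob M R u) \<le> ennreal (exp (- h * u)) * 1"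
      using bound[OF that(1)] mult_left_mono[OF that(2), of "ennreal (exp (- h * u))"]
      by (meson order_trans zero_le)
    then show ?thesis by simp
  qed
  \<comment> \<open>Puts 0 into the set of admissible exponents, as \<open>le_exp_ereal_SUP\<close>
    requires.\<close>
  have "exp_moment M 0 X = 1" for X
    by (simp add: exp_moment_def emeasure_space_1)
  then have "ereal (ruin_prob M R u) \<le> exp_ereal (- (lundberg_exponent M ?S * ereal u))"
    unfolding lundberg_exponent_def
    by (intro le_exp_ereal_SUP \<open>0 < u\<close>) (use lundberg in simp_all)
  then show ?thesis
    unfolding hit_SUP using bound ruin_prob_eq exp_moment_partial_sum[OF assms(13)] by (simp add: S_eq)
qed

end
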